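(* The following are equivalent for every convex body $K \subseteq \mathbb{R}^n$. (i) $i(K,R(K)) < \infty$. (ii) $\sup_{0 < \varrho < R(K)} c(K,\varrho) < \infty$. (iii) There is a finite set $\{x_1,\dots,x_k\} \subseteq K \cap \mathrm{bd}(B(c_K,R(K)))$ such that $\bigcup_{i=1}^k (K + (c_K - x_i))$ covers a neighborhood of $c_K$ in $K$, i.e., $$\exists \delta > 0 \ \left( K \cap B^o(c_K,\delta) \subseteq \bigcup_{i=1}^k (K + (c_K - x_i)) \right).$$ (iv) There is a finite set $\{x_1,\dots,x_k\} \subseteq K \cap \mathrm{bd}(B(c_K,R(K)))$ such that $\bigcup_{i=1}^k (K + (c_K - x_i))$ covers a neighborhood of $c_K$, i.e., $$\exists \delta > 0 \ \left( B^o(c_K,\delta) \subseteq \bigcup_{i=1}^k (K + (c_K - x_i)) \right).$$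
   Context: A convex body $K \subseteq \mathbb{R}^n$ is a compact convex set with nonempty interior; $\|\cdot\|$ is the Euclidean norm, $S^{n-1} = \{x \in \mathbb{R}^n : \|x\| = 1\}$, $\mathrm{bd}$ denotes the boundary, and $B(x_0,r) = \{x : \|x - x_0\| \le r\}$, $B^o(x_0,r) = \{x : \|x-x_0\| < r\}$ are closed and open balls. The circumball $B(c_K,R(K))$ of $K$ is the unique closed ball of minimal radius containing $K$; $c_K$ is the circumcenter and $R(K)$ the circumradius of $K$. For $\varepsilon > 0$ define $$c(K,\varepsilon) = \min\{m : \exists r_1,\dots,r_m \in S^{n-1} \ \forall x \in K \ \exists i \ (x + \varepsilon r_i \in \mathrm{int}(K))\},$$ $$i(K,\varepsilon) = \min\{m : \exists r_1,\dots,r_m \in S^{n-1} \ \forall x \in K \ \exists i \ (x + \varepsilon r_i \in K)\},$$ where in each case the value is $\infty$ if no such $m$ exists. *)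

theory Defs
  imports "HOL-Analysis.Analysis" "HOL-Library.Extended_Nat"
begin

definition convex_body :: "'a::euclidean_space set \<Rightarrow> bool" where
  "convex_body K \<longleftrightarrow> compact K \<and> convex K \<and> interior K \<noteq> {}"

text \<open>For a nonempty bounded set the minimum and the unique centre below exist; see
  \<open>circumradius_le\<close> and \<open>circumball_unique\<close>.\<close>

definition circumradius :: "'a::euclidean_space set \<Rightarrow> real" where
  "circumradius K = (LEAST r. \<exists>c. K \<subseteq> cball c r)"

definition circumcenter :: "'a::euclidean_space set \<Rightarrow> 'a" where
  "circumcenter K = (THE c. K \<subseteq> cball c (circumradius K))"

text \<open>The infimum in \<^typ>\<open>enat\<close> is the minimum of a nonempty set and \<open>\<infinity>\<close> for the empty set.\<close>

definition c_illum :: "'a::euclidean_space set \<Rightarrow> real \<Rightarrow> enat" where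
  "c_illum K \<epsilon> = Inf {enat m | m. \<exists>r :: nat \<Rightarrow> 'a. (\<forall>i\<in>{1..m}. r i \<in> sphere 0 1) \<and>
      (\<forall>x\<in>K. \<exists>i\<in>{1..m}. x + \<epsilon> *\<^sub>R r i \<in> interior K)}"

definition i_illum :: "'a::euclidean_space set \<Rightarrow> real \<Rightarrow> enat" where
  "i_illum K \<epsilon> = Inf {enat m | m. \<exists>r :: nat \<Rightarrow> 'a. (\<forall>i\<in>{1..m}. r i \<in> sphere 0 1) \<and>
      (\<forall>x\<in>K. \<exists>i\<in>{1..m}. x + \<epsilon> *\<^sub>R r i \<in> K)}"

lemma minimal_ball_exists:
  fixes K :: "'a::euclidean_space set"
  assumes "K \<noteq> {}" "bounded K"
  shows "\<exists>R. (\<exists>c. K \<subseteq> cball c R) \<and> (\<forall>r. (\<exists>c. K \<subseteq> cball c r) \<longrightarrow> R \<le> r)"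
proof -
  define S where "S = {r. \<exists>c. K \<subseteq> cball c r}"
  obtain p where p: "p \<in> K" using assms by blast
  have "S \<noteq> {}" using assms(2) unfolding bounded_def S_def by (force simp: subset_iff)
  have lb: "0 \<le> r" if "r \<in> S" for r
  proof -
    from that p obtain c where "dist c p \<le> r" unfolding S_def by auto
    then show ?thesis using zero_le_dist[of c p] by linarith
  qed
  have bb: "bdd_below S" using lb by (meson bdd_belowI)
  define F where "F n = (\<Inter>x\<in>K. cball x (Inf S + 1 / real (Suc n)))" for n
  have F_iff: "c \<in> F n \<longleftrightarrow> K \<subseteq> cball c (Inf S + 1 / real (Suc n))" for c n
    by (auto simp: F_def subset_iff dist_commute)
  have "\<Inter> (range F) \<noteq> {}"
  proof (rule compact_nest)
    show "compact (F n)" for n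
      unfolding F_def using p by (intro compact_Inter) auto
    show "F n \<noteq> {}" for n
    proof -
      obtain r where "r \<in> S" "r < Inf S + 1 / real (Suc n)"
        using cInf_lessD[OF \<open>S \<noteq> {}\<close>, of "Inf S + 1 / real (Suc n)"] by auto
      then obtain c where "K \<subseteq> cball c r" by (auto simp: S_def)
      then have "K \<subseteq> cball c (Inf S + 1 / real (Suc n))"
        using \<open>r < _\<close> subset_cball[of r "Inf S + 1 / real (Suc n)" c] by auto
      then show ?thesis using F_iff by blast
    qed
    show "F n \<subseteq> F m" if "m \<le> n" for m n
    proof -
      have "1 / real (Suc n) \<le> 1 / real (Suc m)" using that by (simp add: frac_le)
      then show ?thesis unfolding F_def by (intro INF_mono') (auto intro!: subset_cball)
    qed
  qed
  then obtain c where c: "\<And>n. K \<subseteq> cball c (Inf S + 1 / real (Suc n))"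
    using F_iff by blast
  have "K \<subseteq> cball c (Inf S)"
  proof
    fix x assume "x \<in> K"
    have "dist c x \<le> Inf S + e" if "e > 0" for e
    proof -
      obtain n where "1 / real (Suc n) < e" using nat_approx_posE[OF \<open>e > 0\<close>] by blast
      moreover have "dist c x \<le> Inf S + 1 / real (Suc n)" using c \<open>x \<in> K\<close> by (meson mem_cball subsetD)
      ultimately show ?thesis by linarith
    qed
    then show "x \<in> cball c (Inf S)" by (simp add: field_le_epsilon)
  qed
  moreover have "Inf S \<le> r" if "K \<subseteq> cball d r" for d r
    using that bb by (intro cInf_lower) (auto simp: S_def)
  ultimately show ?thesis by blast
qed

lemma
  fixes K :: "'a::euclidean_space set"
  assumes "K \<noteq> {}" "bounded K"
  shows circumradius_attained: "\<exists>c. K \<subseteq> cball c (circumradius K)"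
    and circumradius_le: "K \<subseteq> cball d r \<Longrightarrow> circumradius K \<le> r"
proof -
  obtain R where R: "\<exists>c. K \<subseteq> cball c R" "\<And>r. \<exists>c. K \<subseteq> cball c r \<Longrightarrow> R \<le> r"
    using minimal_ball_exists[OF assms] by blast
  have "circumradius K = R"
    unfolding circumradius_def using R by (rule Least_equality)
  then show "\<exists>c. K \<subseteq> cball c (circumradius K)"
    and "K \<subseteq> cball d r \<Longrightarrow> circumradius K \<le> r" using R by blast+
qed

lemma circumball_unique:
  fixes K :: "'a::euclidean_space set"
  assumes "K \<noteq> {}" "bounded K"
  shows "\<exists>!c. K \<subseteq> cball c (circumradius K)"
proof (rule ex_ex1I[OF circumradius_attained[OF assms]])
  fix c d assume c: "K \<subseteq> cball c (circumradius K)" and d: "K \<subseteq> cball d (circumradius K)"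
  let ?R = "circumradius K" and ?m = "(1/2) *\<^sub>R (c + d)"
  obtain p where "p \<in> K" using assms by blast
  then have "dist c p \<le> ?R" using c by auto
  then have R0: "0 \<le> ?R" using zero_le_dist[of c p] by linarith
  have main: "(dist ?m x)\<^sup>2 \<le> ?R\<^sup>2 - (dist c d)\<^sup>2 / 4" if "x \<in> K" for x
  proof -
    have "(dist c x)\<^sup>2 \<le> ?R\<^sup>2" "(dist d x)\<^sup>2 \<le> ?R\<^sup>2"
      using c d that by (auto intro!: power_mono)
    moreover have "(dist ?m x)\<^sup>2 = ((dist c x)\<^sup>2 + (dist d x)\<^sup>2) / 2 - (dist c d)\<^sup>2 / 4"
      unfolding dist_norm power2_norm_eq_inner
      by (simp add: inner_diff inner_add inner_commute field_simps)
    ultimately show ?thesis by (simp add: field_simps)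
  qed
  have "K \<subseteq> cball ?m (sqrt (?R\<^sup>2 - (dist c d)\<^sup>2 / 4))"
    using main by (auto intro!: real_le_rsqrt)
  from circumradius_le[OF assms this]
  have le: "?R \<le> sqrt (?R\<^sup>2 - (dist c d)\<^sup>2 / 4)" .
  have "0 \<le> ?R\<^sup>2 - (dist c d)\<^sup>2 / 4" using main[OF \<open>p \<in> K\<close>] zero_le_power2[of "dist ?m p"] by linarith
  then have "?R\<^sup>2 \<le> ?R\<^sup>2 - (dist c d)\<^sup>2 / 4"
    using power_mono[OF le R0, of 2] by simp
  then show "c = d" by simp
qed

end

theory Submission
  imports Defs
begin

text \<open>
  Write \<open>c\<close> and \<open>R\<close> for circumcenter and circumradius. A step of length \<open>R\<close> is a problem only near
  \<open>c\<close>. Indeed, \<open>c\<close> is the only centre of a ball of radius \<open>R\<close> around \<open>K\<close>, so every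
  other \<open>y \<in> K\<close> sees an interior point of \<open>K\<close> at distance more than \<open>R\<close>, and stepping towards it
  lands in the interior. Outside a neighbourhood of \<open>c\<close>, compactness leaves finitely many
  directions (lemma \<open>finite_steps_away_from_circumcenter\<close>). At \<open>c\<close> itself a step of
  length \<open>R\<close> inside \<open>K\<close> must end in a contact point of \<open>K\<close> with its circumsphere, and
  a translate \<open>K + (c - x)\<close> consists of the points that the step \<open>x - c\<close> sends into \<open>K\<close>. This is
  why finiteness of \<open>i(K,R)\<close> amounts to covering a neighbourhood of \<open>c\<close> in \<open>K\<close> by such
  translates.

  The key observation is that such a covering forces \<open>c\<close> into the interior of \<open>K\<close> (lemma
  \<open>circumcenter_interior_if_cover\<close>). Otherwise there is \<open>v \<noteq> 0\<close> such that the points \<open>c + t v\<close>, for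
  small \<open>t > 0\<close>, lie in \<open>K\<close>, and \<open>v\<close> makes a nonobtuse angle with \<open>k - c\<close> for all \<open>k \<in> K\<close>.
  Such a step from \<open>c + t v\<close> by \<open>x - c\<close> would end at distance more than \<open>R\<close> from \<open>c\<close>, outside of \<open>K\<close>.
  Hence a neighbourhood of \<open>c\<close> in \<open>K\<close> is the same as a neighbourhood of \<open>c\<close>. Moreover, shortening
  the steps to \<open>\<varrho> < R\<close> moves their end points into the interior, so one set of directions serves
  all \<open>\<varrho>\<close> at once. Conversely, directions for \<open>\<varrho> < R\<close> whose number is bounded subconverge, as
  \<open>\<varrho> \<rightarrow> R\<close>, to directions for \<open>R\<close>.
\<close>

section \<open>The circumball of a convex body\<close>

lemma convex_body_nonempty: "convex_body K \<Longrightarrow> K \<noteq> {}"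
  unfolding convex_body_def using interior_subset by blast

lemma convex_body_bounded: "convex_body K \<Longrightarrow> bounded K"
  by (simp add: convex_body_def compact_imp_bounded)

lemma convex_body_closed: "convex_body K \<Longrightarrow> closed K"
  by (simp add: convex_body_def compact_imp_closed)

lemma circumball_contains:
  assumes "convex_body K"
  shows "K \<subseteq> cball (circumcenter K) (circumradius K)"
  unfolding circumcenter_def
  by (rule theI', rule circumball_unique)
     (use assms convex_body_nonempty convex_body_bounded in auto)

lemma circumcenter_eqI:
  assumes "convex_body K" "K \<subseteq> cball d (circumradius K)"
  shows "d = circumcenter K"
  using circumball_unique[OF convex_body_nonempty convex_body_bounded, OF assms(1,1)]
    circumball_contains[OF assms(1)] assms(2) by blast

lemma circumradius_pos:
  assumes "convex_body K"
  shows "0 < circumradius K"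
proof (rule ccontr)
  assume "\<not> ?thesis"
  then have "cball (circumcenter K) (circumradius K) \<subseteq> {circumcenter K}"
    by (auto simp: not_less simp flip: dist_le_zero_iff simp: dist_commute)
  then have "K \<subseteq> {circumcenter K}"
    using circumball_contains[OF assms] by blast
  then have "interior K \<subseteq> interior {circumcenter K}"
    by (rule interior_mono)
  then show False using assms by (simp add: convex_body_def)
qed

text \<open>Projecting the circumcenter to \<open>K\<close> does not increase its distance to any point of \<open>K\<close>,
  so the projection is again a circumcenter.\<close>

lemma circumcenter_mem:
  assumes "convex_body K"
  shows "circumcenter K \<in> K"
proof -
  define q where "q = closest_point K (circumcenter K)"
  have K: "convex K" "closed K" "K \<noteq> {}"
    using assms convex_body_closed convex_body_nonempty by (auto simp: convex_body_def)
  have "dist q x \<le> dist (circumcenter K) x" if "x \<in> K" for x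
    using closest_point_lipschitz[OF K, of "circumcenter K" x] closest_point_self[OF that]
    by (simp add: q_def)
  then have "K \<subseteq> cball q (circumradius K)"
    using circumball_contains[OF assms] by force
  then have "q = circumcenter K"
    by (rule circumcenter_eqI[OF assms])
  then show ?thesis
    using closest_point_in_set[OF K(2,3)] by (metis q_def)
qed

section \<open>Steps starting away from the circumcenter\<close>

text \<open>As \<open>y\<close> is not the circumcenter, \<open>K\<close> is not within distance \<open>R\<close> of \<open>y\<close>, and neither is its
  interior, which is dense in it. A step towards a far interior point \<open>z\<close> stops between \<open>y\<close> and \<open>z\<close>.\<close>

lemma long_step_into_interior:
  fixes K :: "'a::euclidean_space set"
  assumes K: "convex_body K" and y: "y \<in> K" "y \<noteq> circumcenter K"
  obtains d where "d \<in> sphere 0 1" "y + circumradius K *\<^sub>R d \<in> interior K"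
proof -
  let ?R = "circumradius K"
  have "\<not> K \<subseteq> cball y ?R"
    using circumcenter_eqI[OF K] y(2) by blast
  then obtain w where w: "w \<in> K" "?R < dist y w" by (auto simp: subset_iff not_le)
  have "w \<in> closure (interior K)"
    using w(1) K convex_closure_interior[of K] closure_subset[of K]
    by (auto simp: convex_body_def)
  then obtain z where z: "z \<in> interior K" "dist z w < dist y w - ?R"
    using w(2) by (metis closure_approachable diff_gt_0_iff_gt)
  have far: "?R < norm (z - y)"
    using z(2) dist_triangle[of y w z] by (simp add: dist_norm norm_minus_commute)
  let ?e = "?R / norm (z - y)"
  have "0 < ?e" "?e \<le> 1"
    using far circumradius_pos[OF K] by (auto simp: divide_simps)
  then have "y - ?e *\<^sub>R (y - z) \<in> interior K"
    using mem_interior_closure_convex_shrink[of K z y ?e] K z(1) y(1) closure_subset[of K]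
    by (auto simp: convex_body_def)
  then have "y + ?R *\<^sub>R ((z - y) /\<^sub>R norm (z - y)) \<in> interior K"
    by (simp add: scaleR_diff_right divide_inverse algebra_simps)
  moreover have "(z - y) /\<^sub>R norm (z - y) \<in> sphere 0 1"
    using far circumradius_pos[OF K] by (cases "z = y") auto
  ultimately show thesis using that by blast
qed

text \<open>A direction that works for \<open>y\<close> works for all points near \<open>y\<close>, because the end point of
  the step is an interior point.\<close>

lemma finite_steps_away_from_circumcenter:
  fixes K :: "'a::euclidean_space set"
  assumes K: "convex_body K" and "0 < \<delta>"
  obtains D where "finite D" "D \<subseteq> sphere 0 1"
    "\<And>y. y \<in> K - ball (circumcenter K) \<delta> \<Longrightarrow> \<exists>d\<in>D. y + circumradius K *\<^sub>R d \<in> interior K"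
proof -
  let ?R = "circumradius K"
  define U where "U d = {y. y + ?R *\<^sub>R d \<in> interior K}" for d
  have "open (U d)" for d
  proof -
    have "U d = (\<lambda>y. - (?R *\<^sub>R d) + y) ` interior K"
      by (force simp: U_def image_iff algebra_simps)
    then show ?thesis by (metis open_interior open_translation)
  qed
  moreover have "K - ball (circumcenter K) \<delta> \<subseteq> (\<Union>d\<in>sphere 0 1. U d)"
  proof
    fix y assume "y \<in> K - ball (circumcenter K) \<delta>"
    then have "y \<in> K" "y \<noteq> circumcenter K" using \<open>0 < \<delta>\<close> by auto
    then show "y \<in> (\<Union>d\<in>sphere 0 1. U d)"
      using long_step_into_interior[OF K] by (metis UN_I U_def mem_Collect_eq)
  qed
  moreover have "compact (K - ball (circumcenter K) \<delta>)"
    using K by (simp add: convex_body_def compact_diff)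
  ultimately obtain D where "D \<subseteq> sphere 0 1" "finite D"
      "K - ball (circumcenter K) \<delta> \<subseteq> (\<Union>d\<in>D. U d)"
    using compactE_image[of "K - ball (circumcenter K) \<delta>" "sphere 0 1" U] by blast
  then show thesis using that[of D] unfolding U_def by blast
qed

section \<open>Contact translates near the circumcenter\<close>

text \<open>This says that the cone of \<open>K\<close> at \<open>p\<close> and its dual cone meet, in the strong sense that some \<open>v\<close>
  of the dual cone has \<open>p + v\<close> in the interior of \<open>K\<close>. A hyperplane separating the
  two would have its normal in the dual cone, on whose multiples the separating functional
  is not bounded above.\<close>

lemma interior_meets_dual_cone:
  fixes K :: "'a::euclidean_space set"
  assumes "convex K" "interior K \<noteq> {}"
  obtains v where "p + v \<in> interior K" "\<And>k. k \<in> K \<Longrightarrow> 0 \<le> v \<bullet> (k - p)"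
proof -
  define E where "E = {v. \<forall>k\<in>K. 0 \<le> v \<bullet> (k - p)}"
  define S where "S = (\<lambda>k. - p + k) ` interior K"
  have "E \<inter> S \<noteq> {}"
  proof
    assume disjoint: "E \<inter> S = {}"
    have "convex E"
      unfolding E_def convex_def by (auto simp: inner_add_left)
    moreover have "convex S"
      unfolding S_def using assms(1) by (intro convex_translation convex_interior)
    moreover have "0 \<in> E" "S \<noteq> {}" using assms(2) by (auto simp: E_def S_def)
    ultimately obtain a b where ab: "a \<noteq> 0" "\<And>e. e \<in> E \<Longrightarrow> a \<bullet> e \<le> b" "\<And>s. s \<in> S \<Longrightarrow> b \<le> a \<bullet> s"
      using separating_hyperplane_sets[of E S] disjoint by blast
    have "0 \<le> b" using ab(2)[OF \<open>0 \<in> E\<close>] by simp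
    have "interior K \<subseteq> {k. a \<bullet> p \<le> a \<bullet> k}"
    proof
      fix k assume "k \<in> interior K"
      then have "b \<le> a \<bullet> (- p + k)" by (intro ab(3)) (simp add: S_def)
      then show "k \<in> {k. a \<bullet> p \<le> a \<bullet> k}"
        using \<open>0 \<le> b\<close> by (simp add: inner_diff_right)
    qed
    then have "closure (interior K) \<subseteq> {k. a \<bullet> p \<le> a \<bullet> k}"
      by (intro closure_minimal closed_halfspace_component_ge) (auto simp: closed_halfspace_ge)
    then have "K \<subseteq> {k. a \<bullet> p \<le> a \<bullet> k}"
      using convex_closure_interior[OF assms] closure_subset by blast
    then have "t *\<^sub>R a \<in> E" if "0 \<le> t" for t
      using that by (auto simp: E_def inner_diff_right intro!: mult_left_mono)
    then have bound: "t * (a \<bullet> a) \<le> b" if "0 \<le> t" for t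
      using ab(2) that by fastforce
    have "0 < a \<bullet> a" using ab(1) by simp
    then have "((b + 1) / (a \<bullet> a)) * (a \<bullet> a) = b + 1" by simp
    then show False using bound[of "(b + 1) / (a \<bullet> a)"] \<open>0 \<le> b\<close> \<open>0 < a \<bullet> a\<close> by simp
  qed
  then obtain v where "v \<in> E" "v \<in> S" by blast
  then have "p + v \<in> interior K" "\<And>k. k \<in> K \<Longrightarrow> 0 \<le> v \<bullet> (k - p)"
    by (auto simp: E_def S_def)
  then show thesis by (rule that)
qed

text \<open>A vector \<open>v\<close> as in the previous lemma for \<open>p = c\<close> must vanish: for small \<open>t > 0\<close> the point
  \<open>c + t v\<close> is covered by some translate, and then \<open>x + t v\<close> with \<open>\<parallel>x - c\<parallel> = R\<close> lies in \<open>K\<close>,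
  which the angle between \<open>v\<close> and \<open>x - c\<close> does not permit.\<close>

lemma circumcenter_interior_if_cover:
  fixes K :: "'a::euclidean_space set"
  defines "c \<equiv> circumcenter K" and "R \<equiv> circumradius K"
  assumes K: "convex_body K" and X: "X \<subseteq> K \<inter> sphere c R" and "0 < \<delta>"
    and cover: "K \<inter> ball c \<delta> \<subseteq> (\<Union>x\<in>X. (\<lambda>y. y + (c - x)) ` K)"
  shows "c \<in> interior K"
proof -
  obtain v where v: "c + v \<in> interior K" "\<And>k. k \<in> K \<Longrightarrow> 0 \<le> v \<bullet> (k - c)"
    using interior_meets_dual_cone[of K c] K by (auto simp: convex_body_def)
  have "v = 0"
  proof (rule ccontr)
    assume "v \<noteq> 0"
    \<comment> \<open>Here \<open>t \<le> 1\<close> keeps \<open>c + t v\<close> in \<open>K\<close>, and \<open>t \<parallel>v\<parallel> \<le> \<delta> / 2\<close> in the covered ball.\<close>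
    define t where "t = min 1 (\<delta> / (2 * norm v))"
    have t: "0 < t" "t \<le> 1" using \<open>0 < \<delta>\<close> \<open>v \<noteq> 0\<close> by (auto simp: t_def)
    have "t * norm v \<le> \<delta> / (2 * norm v) * norm v"
      by (intro mult_right_mono) (auto simp: t_def)
    then have "t * norm v < \<delta>" using \<open>0 < \<delta>\<close> \<open>v \<noteq> 0\<close> by simp
    then have "c + t *\<^sub>R v \<in> ball c \<delta>" using t by (simp add: dist_norm)
    moreover have "c + t *\<^sub>R v \<in> K"
    proof -
      have "(1 - t) *\<^sub>R c + t *\<^sub>R (c + v) \<in> K"
        using K t v(1) interior_subset[of K] circumcenter_mem[OF K] c_def
        by (intro convexD) (auto simp: convex_body_def)
      then show ?thesis by (simp add: algebra_simps)
    qed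
    ultimately obtain x k where x: "x \<in> X" and k: "k \<in> K" "c + t *\<^sub>R v = k + (c - x)"
      using cover by blast
    have kc: "k - c = t *\<^sub>R v + (x - c)" using k(2) by (simp add: algebra_simps)
    have "(norm (k - c))\<^sup>2 = (norm (t *\<^sub>R v))\<^sup>2 + 2 * (t * (v \<bullet> (x - c))) + (norm (x - c))\<^sup>2"
      unfolding kc power2_norm_eq_inner
      by (simp add: inner_add_left inner_add_right inner_commute[of "x - c" v]
          distrib_left del: add_diff_eq)
    moreover have "(norm (x - c))\<^sup>2 = R\<^sup>2" using x X by (auto simp: dist_norm norm_minus_commute)
    moreover have "0 \<le> t * (v \<bullet> (x - c))" using v(2) x X t by auto
    moreover have "0 < (norm (t *\<^sub>R v))\<^sup>2" using t \<open>v \<noteq> 0\<close> by simp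
    ultimately have "R\<^sup>2 < (norm (k - c))\<^sup>2" by linarith
    moreover have "norm (k - c) \<le> R"
      using circumball_contains[OF K] k(1)
      by (auto simp: c_def R_def dist_norm norm_minus_commute)
    ultimately show False
      using power_mono[of "norm (k - c)" R 2] by simp
  qed
  then show ?thesis using v(1) by simp
qed

section \<open>Numbers of directions as cardinalities\<close>

definition step_cover :: "'a::real_normed_vector set \<Rightarrow> 'a set \<Rightarrow> real \<Rightarrow> 'a set \<Rightarrow> bool" where
  "step_cover K T \<epsilon> D \<longleftrightarrow> finite D \<and> D \<subseteq> sphere 0 1 \<and> (\<forall>x\<in>K. \<exists>d\<in>D. x + \<epsilon> *\<^sub>R d \<in> T)"

text \<open>Both illumination numbers are of the form on the left, with \<open>T\<close> being \<open>interior K\<close> or \<open>K\<close>.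
  As the enumerations there may repeat directions, the cardinality is bounded and not
  prescribed.\<close>

lemma least_number_of_directions_le_iff:
  "Inf {enat m | m. \<exists>r :: nat \<Rightarrow> 'a::real_normed_vector. (\<forall>i\<in>{1..m}. r i \<in> sphere 0 1) \<and>
      (\<forall>x\<in>K. \<exists>i\<in>{1..m}. x + \<epsilon> *\<^sub>R r i \<in> T)} \<le> enat m \<longleftrightarrow>
    (\<exists>D. step_cover K T \<epsilon> D \<and> card D \<le> m)" (is "Inf ?N \<le> _ \<longleftrightarrow> _")
proof
  assume le: "Inf ?N \<le> enat m"
  then have "?N \<noteq> {}" by (auto simp: Inf_enat_def split: if_splits)
  then have "\<exists>a. a \<in> ?N" by (simp only: ex_in_conv simp_thms)
  then have "Inf ?N \<in> ?N" by (rule exE) (rule wellorder_InfI)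
  then obtain k and r :: "nat \<Rightarrow> 'a" where k: "Inf ?N = enat k" and
    r: "\<forall>i\<in>{1..k}. r i \<in> sphere 0 1" "\<forall>x\<in>K. \<exists>i\<in>{1..k}. x + \<epsilon> *\<^sub>R r i \<in> T"
    by blast
  have "step_cover K T \<epsilon> (r ` {1..k})" using r by (auto simp: step_cover_def)
  moreover have "card (r ` {1..k}) \<le> m"
    using card_image_le[of "{1..k}" r] le k by simp
  ultimately show "\<exists>D. step_cover K T \<epsilon> D \<and> card D \<le> m" by blast
next
  assume "\<exists>D. step_cover K T \<epsilon> D \<and> card D \<le> m"
  then obtain D where D: "step_cover K T \<epsilon> D" "card D \<le> m" by blast
  define k where "k = card D"
  obtain r where "bij_betw r {1..k} D"
    using ex_bij_betw_nat_finite_1 D(1) unfolding step_cover_def k_def by blast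
  then have "step_cover K T \<epsilon> (r ` {1..k})" using D(1) by (simp add: bij_betw_def)
  then have "(\<forall>i\<in>{1..k}. r i \<in> sphere 0 1) \<and> (\<forall>x\<in>K. \<exists>i\<in>{1..k}. x + \<epsilon> *\<^sub>R r i \<in> T)"
    unfolding step_cover_def by blast
  then have "Inf ?N \<le> enat k" by (intro Inf_lower) blast
  also have "\<dots> \<le> enat m" using D(2) by (simp add: k_def)
  finally show "Inf ?N \<le> enat m" .
qed

lemma c_illum_le_iff:
  "c_illum K \<epsilon> \<le> enat m \<longleftrightarrow> (\<exists>D. step_cover K (interior K) \<epsilon> D \<and> card D \<le> m)"
  unfolding c_illum_def by (rule least_number_of_directions_le_iff)

lemma i_illum_le_iff:
  "i_illum K \<epsilon> \<le> enat m \<longleftrightarrow> (\<exists>D. step_cover K K \<epsilon> D \<and> card D \<le> m)"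
  unfolding i_illum_def by (rule least_number_of_directions_le_iff)

lemma enat_finite_iff_bounded: "(a :: enat) < \<infinity> \<longleftrightarrow> (\<exists>m. a \<le> enat m)"
  by (metis enat_ord_code(4) less_infinityE order.refl order.strict_trans1)

lemma i_illum_finite_iff: "i_illum K \<epsilon> < \<infinity> \<longleftrightarrow> (\<exists>D. step_cover K K \<epsilon> D)"
  unfolding enat_finite_iff_bounded i_illum_le_iff by blast

lemma SUP_c_illum_finite_iff:
  "(SUP \<rho>\<in>A. c_illum K \<rho>) < \<infinity> \<longleftrightarrow>
    (\<exists>m. \<forall>\<rho>\<in>A. \<exists>D. step_cover K (interior K) \<rho> D \<and> card D \<le> m)"
  unfolding enat_finite_iff_bounded SUP_le_iff c_illum_le_iff ..

section \<open>The implications\<close>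

text \<open>A direction whose step from \<open>c\<close> leaves \<open>K\<close> is useless also for the points near \<open>c\<close>.
  The remaining directions lead from \<open>c\<close> to contact points.\<close>

lemma cover_if_step_cover_circumradius:
  fixes K :: "'a::euclidean_space set"
  defines "c \<equiv> circumcenter K" and "R \<equiv> circumradius K"
  assumes K: "convex_body K" and D: "step_cover K K R D"
  shows "\<exists>X. finite X \<and> X \<subseteq> K \<inter> sphere c R \<and>
    (\<exists>\<delta>>0. K \<inter> ball c \<delta> \<subseteq> (\<Union>x\<in>X. (\<lambda>y. y + (c - x)) ` K))"
proof -
  \<comment> \<open>The set \<open>F\<close> consists of the points that a direction useless at \<open>c\<close> sends into \<open>K\<close>.\<close>
  define G where "G = {d \<in> D. c + R *\<^sub>R d \<in> K}"
  define X where "X = (\<lambda>d. c + R *\<^sub>R d) ` G"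
  define F where "F = (\<Union>d\<in>D - G. (\<lambda>y. - (R *\<^sub>R d) + y) ` K)"
  have finD: "finite D" and sphD: "D \<subseteq> sphere 0 1"
    and cov: "\<And>x. x \<in> K \<Longrightarrow> \<exists>d\<in>D. x + R *\<^sub>R d \<in> K"
    using D by (auto simp: step_cover_def)
  have "closed F"
    unfolding F_def using finD
    by (intro closed_UN ballI closed_translation convex_body_closed[OF K]) auto
  moreover have "c \<notin> F" by (auto simp: F_def G_def)
  ultimately obtain \<delta> where \<delta>: "0 < \<delta>" "ball c \<delta> \<inter> F = {}"
    using open_contains_ball[of "- F"] by (auto simp: open_Compl disjoint_eq_subset_Compl)
  have "K \<inter> ball c \<delta> \<subseteq> (\<Union>x\<in>X. (\<lambda>y. y + (c - x)) ` K)"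
  proof
    fix y assume y: "y \<in> K \<inter> ball c \<delta>"
    then obtain d where d: "d \<in> D" "y + R *\<^sub>R d \<in> K" using cov by blast
    have "d \<in> G"
    proof (rule ccontr)
      assume "d \<notin> G"
      moreover have "y = - (R *\<^sub>R d) + (y + R *\<^sub>R d)" by simp
      ultimately have "y \<in> F" using d unfolding F_def by blast
      then show False using \<delta>(2) y by blast
    qed
    moreover have "y = (y + R *\<^sub>R d) + (c - (c + R *\<^sub>R d))" by simp
    ultimately show "y \<in> (\<Union>x\<in>X. (\<lambda>y. y + (c - x)) ` K)"
      using d(2) unfolding X_def by blast
  qed
  moreover have "finite X" using finD by (simp add: X_def G_def)
  moreover have "X \<subseteq> K \<inter> sphere c R"
    using sphD circumradius_pos[OF K] by (auto simp: X_def G_def dist_norm R_def)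
  ultimately show ?thesis using \<delta>(1) by blast
qed

text \<open>The end point of a step of length \<open>\<rho> < R\<close> lies strictly between the end points of the step
  of length \<open>R\<close> in the same direction. Both belong to \<open>K\<close> and one is an interior point: the start
  near \<open>c\<close>, the end away from \<open>c\<close>. So the directions do not depend on \<open>\<rho>\<close>.\<close>

lemma uniform_step_cover_if_cover:
  fixes K :: "'a::euclidean_space set"
  defines "c \<equiv> circumcenter K" and "R \<equiv> circumradius K"
  assumes K: "convex_body K" and X: "finite X" "X \<subseteq> K \<inter> sphere c R" and "0 < \<delta>"
    and cover: "K \<inter> ball c \<delta> \<subseteq> (\<Union>x\<in>X. (\<lambda>y. y + (c - x)) ` K)"
  shows "\<exists>D. \<forall>\<rho>\<in>{0<..<R}. step_cover K (interior K) \<rho> D"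
proof -
  have "0 < R" using circumradius_pos[OF K] by (simp add: R_def)
  have "convex K" using K by (simp add: convex_body_def)
  have "c \<in> interior K"
    using circumcenter_interior_if_cover[OF K] X(2) \<open>0 < \<delta>\<close> cover by (simp add: c_def R_def)
  then obtain \<gamma> where \<gamma>: "0 < \<gamma>" "ball c \<gamma> \<subseteq> interior K"
    by (meson open_contains_ball open_interior)
  obtain D where D: "finite D" "D \<subseteq> sphere 0 1"
    "\<And>y. y \<in> K - ball c (min \<gamma> \<delta>) \<Longrightarrow> \<exists>d\<in>D. y + R *\<^sub>R d \<in> interior K"
    using finite_steps_away_from_circumcenter[OF K, of "min \<gamma> \<delta>"] \<gamma>(1) \<open>0 < \<delta>\<close>
    by (auto simp: c_def R_def)
  define D' where "D' = D \<union> (\<lambda>x. (x - c) /\<^sub>R R) ` X"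
  have "step_cover K (interior K) \<rho> D'" if \<rho>: "\<rho> \<in> {0<..<R}" for \<rho>
  proof -
    have "finite D'" using D(1) X(1) by (simp add: D'_def)
    moreover have "D' \<subseteq> sphere 0 1"
      using D(2) X(2) \<open>0 < R\<close> by (auto simp: D'_def dist_norm norm_minus_commute)
    moreover have "\<exists>d\<in>D'. y + \<rho> *\<^sub>R d \<in> interior K" if y: "y \<in> K" for y
    proof (cases "y \<in> ball c (min \<gamma> \<delta>)")
      case True
      then obtain x k where x: "x \<in> X" and k: "k \<in> K" "y = k + (c - x)"
        using cover y by force
      have "k - (1 - \<rho> / R) *\<^sub>R (k - y) \<in> interior K"
        using True \<gamma>(2) \<rho> \<open>convex K\<close> k(1) closure_subset[of K]
        by (intro mem_interior_closure_convex_shrink) (auto simp: divide_simps)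
      moreover have "k - y = x - c" using k(2) by simp
      ultimately have "k - (1 - \<rho> / R) *\<^sub>R (x - c) \<in> interior K" by simp
      moreover have "k - (1 - \<rho> / R) *\<^sub>R (x - c) = y + \<rho> *\<^sub>R ((x - c) /\<^sub>R R)"
        using k(2) by (simp add: scaleR_diff_left divide_inverse)
      moreover have "(x - c) /\<^sub>R R \<in> D'" using x unfolding D'_def by blast
      ultimately show ?thesis by metis
    next
      case False
      then obtain d where d: "d \<in> D" "y + R *\<^sub>R d \<in> interior K" using D(3) y by blast
      have "y - (\<rho> / R) *\<^sub>R (y - (y + R *\<^sub>R d)) \<in> interior K"
        using d(2) \<rho> \<open>convex K\<close> y closure_subset[of K]
        by (intro mem_interior_closure_convex_shrink) (auto simp: divide_simps)
      then have "y + \<rho> *\<^sub>R d \<in> interior K" using \<open>0 < R\<close> by simp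
      then show ?thesis using d(1) unfolding D'_def by blast
    qed
    ultimately show ?thesis by (simp add: step_cover_def)
  qed
  then show ?thesis by blast
qed

lemma compact_funs_into_compact:
  fixes S :: "'a::topological_space set"
  assumes "compact S"
  shows "compact {f :: 'i \<Rightarrow> 'a. \<forall>i. f i \<in> S}"
proof -
  have "compactin (product_topology (\<lambda>i. euclidean) UNIV) (PiE (UNIV :: 'i set) (\<lambda>_. S))"
    using assms by (simp add: compactin_PiE)
  moreover have "PiE (UNIV :: 'i set) (\<lambda>_. S) = {f. \<forall>i. f i \<in> S}" by auto
  ultimately show ?thesis by (simp add: euclidean_product_topology)
qed

text \<open>Along a sequence of step lengths tending to \<open>R\<close>, tuples of \<open>m\<close> directions have a convergent
  subsequence. A point \<open>x\<close> uses some index infinitely often, and the limit direction with that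
  index serves \<open>x\<close>. Only the bound on the number of directions makes this argument possible.\<close>

lemma step_cover_limit:
  fixes K :: "'a::euclidean_space set"
  assumes "closed K" "0 < R"
    and D: "\<And>\<rho>. \<rho> \<in> {0<..<R} \<Longrightarrow> \<exists>D. step_cover K K \<rho> D \<and> card D \<le> m"
  shows "\<exists>D. step_cover K K R D"
proof -
  define \<rho> where "\<rho> n = R * (1 - inverse (real (Suc (Suc n))))" for n
  have \<rho>: "\<rho> n \<in> {0<..<R}" for n
    using \<open>0 < R\<close> by (auto simp: \<rho>_def field_simps add_pos_nonneg)
  have \<rho>_lim: "\<rho> \<longlonglongrightarrow> R"
  proof -
    have "(\<lambda>n. inverse (real (Suc (Suc n)))) \<longlonglongrightarrow> 0"
      using LIMSEQ_Suc[OF LIMSEQ_inverse_real_of_nat] .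
    then have "(\<lambda>n. R * (1 - inverse (real (Suc (Suc n))))) \<longlonglongrightarrow> R * (1 - 0)"
      by (intro tendsto_intros)
    then show ?thesis by (simp add: \<rho>_def[abs_def])
  qed
  \<comment> \<open>The vector \<open>u\<close> pads the direction sets, so that all steps use the same index set.\<close>
  obtain u :: 'a where u: "u \<in> sphere 0 1"
    using vector_choose_size[of 1] by (metis mem_sphere_0 zero_le_one)
  have "\<exists>r :: nat \<Rightarrow> 'a. (\<forall>i. r i \<in> sphere 0 1) \<and> (\<forall>x\<in>K. \<exists>i<m. x + \<rho> n *\<^sub>R r i \<in> K)" for n
  proof -
    obtain D where D: "step_cover K K (\<rho> n) D" "card D \<le> m" using D[OF \<rho>] by blast
    then obtain h where "bij_betw h {0..<card D} D"
      using ex_bij_betw_nat_finite unfolding step_cover_def by blast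
    then have h: "h ` {0..<card D} = D" by (simp add: bij_betw_def)
    let ?r = "\<lambda>i. if i < card D then h i else u"
    have "?r i \<in> sphere 0 1" for i
      using h D(1) u by (fastforce simp: step_cover_def)
    moreover have "\<exists>i<m. x + \<rho> n *\<^sub>R ?r i \<in> K" if x: "x \<in> K" for x
    proof -
      obtain d where "d \<in> D" "x + \<rho> n *\<^sub>R d \<in> K"
        using x D(1) by (auto simp: step_cover_def)
      moreover from \<open>d \<in> D\<close> obtain i where "i < card D" "h i = d"
        by (metis h imageE atLeastLessThan_iff)
      ultimately show ?thesis using D(2) by (intro exI[of _ i]) auto
    qed
    ultimately show ?thesis by (intro exI[of _ ?r]) blast
  qed
  then obtain r :: "nat \<Rightarrow> nat \<Rightarrow> 'a" where r: "\<And>n i. r n i \<in> sphere 0 1"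
    "\<And>n x. x \<in> K \<Longrightarrow> \<exists>i<m. x + \<rho> n *\<^sub>R r n i \<in> K" by metis
  have "seq_compact {f :: nat \<Rightarrow> 'a. \<forall>i. f i \<in> sphere 0 1}"
    by (intro compact_imp_seq_compact compact_funs_into_compact) simp
  then obtain l s where l: "\<And>i. l i \<in> sphere 0 1" and s: "strict_mono s" "(r \<circ> s) \<longlonglongrightarrow> l"
    using r(1) by (auto elim!: seq_compactE[of _ r])
  have lim: "(\<lambda>n. r (s n) i) \<longlonglongrightarrow> l i" for i
    using continuous_on_tendsto_compose[OF continuous_on_product_coordinates[of i] s(2)]
    by (simp add: comp_def)
  have "\<exists>i<m. x + R *\<^sub>R l i \<in> K" if x: "x \<in> K" for x
  proof -
    have "\<exists>i<m. \<exists>\<^sub>\<infinity>n. x + \<rho> (s n) *\<^sub>R r (s n) i \<in> K"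
    proof (rule ccontr)
      assume "\<not> ?thesis"
      then have "\<forall>i\<in>{..<m}. \<forall>\<^sub>\<infinity>n. x + \<rho> (s n) *\<^sub>R r (s n) i \<notin> K"
        by (auto simp: not_INFM)
      then have "\<forall>\<^sub>\<infinity>n. \<forall>i\<in>{..<m}. x + \<rho> (s n) *\<^sub>R r (s n) i \<notin> K"
        by (simp add: eventually_ball_finite)
      then have "\<forall>\<^sub>\<infinity>n::nat. False"
        by (rule eventually_mono) (use r(2)[OF x] in auto)
      then show False by simp
    qed
    then obtain i where i: "i < m" "\<exists>\<^sub>\<infinity>n. x + \<rho> (s n) *\<^sub>R r (s n) i \<in> K" by blast
    have "(\<lambda>n. \<rho> (s n)) \<longlonglongrightarrow> R"
      using LIMSEQ_subseq_LIMSEQ[OF \<rho>_lim s(1)] by (simp add: comp_def)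
    then have step_lim: "(\<lambda>n. x + \<rho> (s n) *\<^sub>R r (s n) i) \<longlonglongrightarrow> x + R *\<^sub>R l i"
      by (intro tendsto_intros lim)
    have "x + R *\<^sub>R l i \<in> K"
    proof (rule ccontr)
      assume "x + R *\<^sub>R l i \<notin> K"
      then have "\<forall>\<^sub>F n in sequentially. x + \<rho> (s n) *\<^sub>R r (s n) i \<in> - K"
        using \<open>closed K\<close> by (intro topological_tendstoD[OF step_lim]) auto
      then show False
        using i(2) by (simp add: frequently_def cofinite_eq_sequentially)
    qed
    then show ?thesis using i(1) by blast
  qed
  then have "step_cover K K R (l ` {..<m})"
    using l by (auto simp: step_cover_def)
  then show ?thesis by blast
qed

theorem theorem5p1:
  fixes K :: "(real ^ 'n) set"
  assumes "convex_body K"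
  shows "let c = circumcenter K; R = circumradius K;
      P_i = i_illum K R < \<infinity>;
      P_ii = (SUP \<rho>\<in>{0<..<R}. c_illum K \<rho>) < \<infinity>;
      P_iii = (\<exists>X. finite X \<and> X \<subseteq> K \<inter> frontier (cball c R) \<and>
        (\<exists>\<delta>>0. K \<inter> ball c \<delta> \<subseteq> (\<Union>x\<in>X. (\<lambda>y. y + (c - x)) ` K)));
      P_iv = (\<exists>X. finite X \<and> X \<subseteq> K \<inter> frontier (cball c R) \<and>
        (\<exists>\<delta>>0. ball c \<delta> \<subseteq> (\<Union>x\<in>X. (\<lambda>y. y + (c - x)) ` K)))
    in (P_i \<longleftrightarrow> P_ii) \<and> (P_ii \<longleftrightarrow> P_iii) \<and> (P_iii \<longleftrightarrow> P_iv)"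
proof -
  define c R where cR: "c = circumcenter K" "R = circumradius K"
  define covers where
    "covers N \<longleftrightarrow> (\<exists>X. finite X \<and> X \<subseteq> K \<inter> frontier (cball c R) \<and>
      (\<exists>\<delta>>0. N \<inter> ball c \<delta> \<subseteq> (\<Union>x\<in>X. (\<lambda>y. y + (c - x)) ` K)))" for N
  have i_iii: "covers K" if i: "i_illum K R < \<infinity>"
  proof -
    obtain D where "step_cover K K R D" using i unfolding i_illum_finite_iff by blast
    then show ?thesis
      unfolding covers_def frontier_cball cR by (rule cover_if_step_cover_circumradius[OF assms])
  qed
  have iii_ii: "(SUP \<rho>\<in>{0<..<R}. c_illum K \<rho>) < \<infinity>" if iii: "covers K"
  proof -
    obtain X \<delta> where "finite X" "X \<subseteq> K \<inter> sphere c R" "0 < \<delta>"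
      "K \<inter> ball c \<delta> \<subseteq> (\<Union>x\<in>X. (\<lambda>y. y + (c - x)) ` K)"
      using iii unfolding covers_def frontier_cball by blast
    then obtain D where "\<forall>\<rho>\<in>{0<..<R}. step_cover K (interior K) \<rho> D"
      using uniform_step_cover_if_cover[OF assms, folded cR] by blast
    then show ?thesis unfolding SUP_c_illum_finite_iff by blast
  qed
  have ii_i: "i_illum K R < \<infinity>" if ii: "(SUP \<rho>\<in>{0<..<R}. c_illum K \<rho>) < \<infinity>"
  proof -
    obtain m where "\<forall>\<rho>\<in>{0<..<R}. \<exists>D. step_cover K (interior K) \<rho> D \<and> card D \<le> m"
      using ii unfolding SUP_c_illum_finite_iff by blast
    moreover have "step_cover K (interior K) \<rho> D \<Longrightarrow> step_cover K K \<rho> D" for \<rho> D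
      unfolding step_cover_def using interior_subset by blast
    ultimately have "\<exists>D. step_cover K K R D"
      by (intro step_cover_limit[of K R m] convex_body_closed[OF assms])
         (use circumradius_pos[OF assms] in \<open>simp add: cR\<close>, blast)
    then show ?thesis unfolding i_illum_finite_iff .
  qed
  have iii_iv: "covers UNIV" if iii: "covers K"
  proof -
    obtain X \<delta> where X: "finite X" "X \<subseteq> K \<inter> frontier (cball c R)" "0 < \<delta>"
      "K \<inter> ball c \<delta> \<subseteq> (\<Union>x\<in>X. (\<lambda>y. y + (c - x)) ` K)"
      using iii unfolding covers_def by blast
    then have "c \<in> interior K"
      using circumcenter_interior_if_cover[OF assms, folded cR, of X \<delta>]
      unfolding frontier_cball by blast
    then obtain \<gamma> where "0 < \<gamma>" "ball c \<gamma> \<subseteq> K" by (auto simp: mem_interior)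
    then have "0 < min \<gamma> \<delta>" "UNIV \<inter> ball c (min \<gamma> \<delta>) \<subseteq> K \<inter> ball c \<delta>"
      using X(3) by auto
    then show ?thesis using X(1,2,4) unfolding covers_def by (meson order_trans)
  qed
  have iv_iii: "covers K" if "covers UNIV"
  proof -
    have "UNIV \<inter> B \<subseteq> C \<Longrightarrow> K \<inter> B \<subseteq> C" for B C by blast
    then show ?thesis using that unfolding covers_def by meson
  qed
  have "(i_illum K R < \<infinity> \<longleftrightarrow> (SUP \<rho>\<in>{0<..<R}. c_illum K \<rho>) < \<infinity>) \<and>
      ((SUP \<rho>\<in>{0<..<R}. c_illum K \<rho>) < \<infinity> \<longleftrightarrow> covers K) \<and> (covers K \<longleftrightarrow> covers UNIV)"
    using i_iii iii_ii ii_i iii_iv iv_iii by blast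
  then show ?thesis
    unfolding Let_def covers_def cR Int_UNIV_left .
qed

end
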